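(* Consider a finite MDP with state space $\mathcal S$, action space $\mathcal A$, transition kernel $\mathcal T$, discount factor $\gamma\neq0$ (with $\gamma=1$ allowed, i.e. $\gamma\in(0,1]$), regularization $\lambda>0$ and known terminal reward $g:\mathcal S\to\mathbb R$. Suppose the MDP is stochastic and satisfies one of the following sets of assumptions, in which $s_0$ denotes the initial state: (i) the underlying Markov chain is irreducible and aperiodic (i.e. with randomly chosen actions, the underlying Markov chain is irreducible and aperiodic); (ii) the initial state $s_0$ admits a self-loop (i.e. it is possible to transition from this state to itself), and all states can be accessed from the initial state in at most $d$ transitions; (iii) there exist cycles starting at the initial state $s_0$ with lengths $R,R'$ such that $\gcd(R,R')=1$, and all states can be accessed from the initial state in at most $d$ transitions. Suppose further that from every state $s$ we have at least as many actions (with linearly independent resulting transition probabilities) as we have possible future states, that is, $$\mathrm{rank}\{\mathcal T(\cdot|s,a);\ a\in\mathcal A\}=\#\{s':\mathcal T(s'|s,a)>0\text{ for some }a\in\mathcal A\}.$$ Then for any initial state $s_0$, there exists a horizon $T$ such that the time-homogeneous IRL problem is well posed. The following sufficient bounds on $T$ also apply: in case (ii) it is sufficient to take any finite $T\ge d+1$; in case (iii) it is sufficient to take any finite $T\ge d+RR'$.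
   Context: A transition $s\to s'$ is possible if $\mathcal T(s'|s,a)>0$ for some $a\in\mathcal A$. A cycle is a sequence of possible transitions which start and end in the same state; its length is the number of transitions. An irreducible Markov chain is aperiodic if there is no common factor (greater than one) of the lengths of all cycles. The rank is the dimension of the linear span in $\mathbb R^{\mathcal S}$ of the probability vectors $\mathcal T(\cdot|s,a)$, $a\in\mathcal A$. Finite-horizon entropy-regularized MDP: for a time-homogeneous running reward $f:\mathcal S\times\mathcal A\to\mathbb R$ and terminal reward $g$, set $V^*_T=g$ and, for $t=T-1,\dots,0$, $$Q^*_t(s,a)=f(s,a)+\gamma\sum_{s'}\mathcal T(s'|s,a)V^*_{t+1}(s'),\quad V^*_t(s)=\lambda\log\sum_{a}\exp(Q^*_t(s,a)/\lambda),\quad \pi^*_t(a|s)=\exp\big((Q^*_t(s,a)-V^*_t(s))/\lambda\big).$$ Well-posedness: the time-homogeneous IRL problem (at horizon $T$, with initial state $s_0$) is well posed if knowledge of the (time-dependent) entropy-regularized optimal strategy $\pi^*_t(a|s)$ and of the terminal reward $g$ (with $\mathcal T,\gamma,\lambda$ known) is sufficient to uniquely determine a time-homogeneous running reward $f$, if it exists, up to a constant. *)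

theory Defs
  imports "HOL-Analysis.Analysis" "HOL-Probability.Probability_Mass_Function"
begin

text \<open>
  A finite MDP is given by a stochastic transition kernel \<open>K :: 's \<Rightarrow> 'a \<Rightarrow> 's pmf\<close> over finite
  types of states and actions; \<open>pmf (K s a) s'\<close> is the probability of moving from \<open>s\<close> to
  \<open>s'\<close> under action \<open>a\<close>.
\<close>

definition transitions :: "('s \<Rightarrow> 'a \<Rightarrow> 's pmf) \<Rightarrow> ('s \<times> 's) set" where
  "transitions K = {(s, s'). \<exists>a. pmf (K s a) s' > 0}"

text \<open>\<open>(s, s') \<in> transitions K ^^ n\<close> means that \<open>s'\<close> can be reached from \<open>s\<close> in exactly
  \<open>n\<close> possible transitions. The empty sequence of transitions is not a cycle.\<close>

definition has_cycle :: "('s \<Rightarrow> 'a \<Rightarrow> 's pmf) \<Rightarrow> 's \<Rightarrow> nat \<Rightarrow> bool" where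
  "has_cycle K s n \<longleftrightarrow> n > 0 \<and> (s, s) \<in> transitions K ^^ n"

definition irreducible_chain :: "('s \<Rightarrow> 'a \<Rightarrow> 's pmf) \<Rightarrow> bool" where
  "irreducible_chain K \<longleftrightarrow> (\<forall>s s'. (s, s') \<in> (transitions K)\<^sup>*)"

definition aperiodic_chain :: "('s \<Rightarrow> 'a \<Rightarrow> 's pmf) \<Rightarrow> bool" where
  "aperiodic_chain K \<longleftrightarrow> \<not> (\<exists>k>1. \<forall>s n. has_cycle K s n \<longrightarrow> k dvd n)"

definition accessible_within :: "('s \<Rightarrow> 'a \<Rightarrow> 's pmf) \<Rightarrow> 's \<Rightarrow> nat \<Rightarrow> bool" where
  "accessible_within K s\<^sub>0 d \<longleftrightarrow> (\<forall>s. \<exists>n\<le>d. (s\<^sub>0, s) \<in> transitions K ^^ n)"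

definition action_rank :: "('s::finite \<Rightarrow> 'a \<Rightarrow> 's pmf) \<Rightarrow> 's \<Rightarrow> nat" where
  "action_rank K s = dim (span (range (\<lambda>a. (\<chi> s'. pmf (K s a) s') :: real ^ 's)))"

definition action_value ::
    "('s::finite \<Rightarrow> 'a \<Rightarrow> 's pmf) \<Rightarrow> real \<Rightarrow> ('s \<Rightarrow> 'a \<Rightarrow> real) \<Rightarrow> ('s \<Rightarrow> real) \<Rightarrow> 's \<Rightarrow> 'a \<Rightarrow> real" where
  "action_value K \<gamma> f v s a = f s a + \<gamma> * (\<Sum>s'\<in>UNIV. pmf (K s a) s' * v s')"

definition soft_max :: "real \<Rightarrow> ('s \<Rightarrow> 'a::finite \<Rightarrow> real) \<Rightarrow> 's \<Rightarrow> real" where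
  "soft_max lam q s = lam * ln (\<Sum>a\<in>UNIV. exp (q s a / lam))"

text \<open>The optimal quantities carry the horizon \<open>T\<close> and the time \<open>t\<close> as their last indices;
  they are meaningful for \<open>t \<le> T\<close> (value) and \<open>t < T\<close> (action value, policy).\<close>

function opt_value ::
    "('s::finite \<Rightarrow> 'a::finite \<Rightarrow> 's pmf) \<Rightarrow> real \<Rightarrow> real \<Rightarrow> ('s \<Rightarrow> 'a \<Rightarrow> real) \<Rightarrow> ('s \<Rightarrow> real) \<Rightarrow>
     nat \<Rightarrow> nat \<Rightarrow> 's \<Rightarrow> real" where
  "opt_value K \<gamma> lam f g T t =
     (if t < T then soft_max lam (action_value K \<gamma> f (opt_value K \<gamma> lam f g T (t + 1))) else g)"
  by pat_completeness auto
termination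
  by (relation "Wellfounded.measure (\<lambda>(K, \<gamma>, lam, f, g, T, t). T - t)") auto

declare opt_value.simps [simp del]

definition opt_action_value ::
    "('s::finite \<Rightarrow> 'a::finite \<Rightarrow> 's pmf) \<Rightarrow> real \<Rightarrow> real \<Rightarrow> ('s \<Rightarrow> 'a \<Rightarrow> real) \<Rightarrow> ('s \<Rightarrow> real) \<Rightarrow>
     nat \<Rightarrow> nat \<Rightarrow> 's \<Rightarrow> 'a \<Rightarrow> real" where
  "opt_action_value K \<gamma> lam f g T t = action_value K \<gamma> f (opt_value K \<gamma> lam f g T (t + 1))"

definition opt_policy ::
    "('s::finite \<Rightarrow> 'a::finite \<Rightarrow> 's pmf) \<Rightarrow> real \<Rightarrow> real \<Rightarrow> ('s \<Rightarrow> 'a \<Rightarrow> real) \<Rightarrow> ('s \<Rightarrow> real) \<Rightarrow>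
     nat \<Rightarrow> nat \<Rightarrow> 's \<Rightarrow> 'a \<Rightarrow> real" where
  "opt_policy K \<gamma> lam f g T t s a =
     exp ((opt_action_value K \<gamma> lam f g T t s a - opt_value K \<gamma> lam f g T t s) / lam)"

text \<open>
  The problem starts in \<open>s\<^sub>0\<close>, so the strategy at time \<open>t\<close> is only taken to be known in the
  states that can be occupied at time \<open>t\<close>. Well-posedness for this data implies
  well-posedness when the strategy is known at all times in all states.
\<close>

definition generates_policy ::
    "('s::finite \<Rightarrow> 'a::finite \<Rightarrow> 's pmf) \<Rightarrow> real \<Rightarrow> real \<Rightarrow> ('s \<Rightarrow> real) \<Rightarrow> nat \<Rightarrow> 's \<Rightarrow>
     ('s \<Rightarrow> 'a \<Rightarrow> real) \<Rightarrow> (nat \<Rightarrow> 's \<Rightarrow> 'a \<Rightarrow> real) \<Rightarrow> bool" where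
  "generates_policy K \<gamma> lam g T s\<^sub>0 f p \<longleftrightarrow>
     (\<forall>t<T. \<forall>s. (s\<^sub>0, s) \<in> transitions K ^^ t \<longrightarrow>
        (\<forall>a. opt_policy K \<gamma> lam f g T t s a = p t s a))"

definition irl_well_posed ::
    "('s::finite \<Rightarrow> 'a::finite \<Rightarrow> 's pmf) \<Rightarrow> real \<Rightarrow> real \<Rightarrow> ('s \<Rightarrow> real) \<Rightarrow> nat \<Rightarrow> 's \<Rightarrow> bool" where
  "irl_well_posed K \<gamma> lam g T s\<^sub>0 \<longleftrightarrow>
     (\<forall>p f f'. generates_policy K \<gamma> lam g T s\<^sub>0 f p \<and> generates_policy K \<gamma> lam g T s\<^sub>0 f' p \<longrightarrow>
        (\<exists>c. \<forall>s a. f' s a = f s a + c))"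

end

theory Submission imports Defs "HOL-Number_Theory.Cong" begin

text \<open>
  If \<open>f\<close> and \<open>f'\<close> generate the same policy, then the difference \<open>D\<close> of the two value functions
  satisfies \<open>f' s a - f s a = D t s - \<gamma> * \<Sum>s'. K(s'|s,a) * D (t+1) s'\<close> at every \<open>s\<close> that can be
  occupied at time \<open>t\<close>. If \<open>s\<close> can be occupied at two times, subtracting eliminates the rewards,
  and the rank condition shows that the corresponding difference of \<open>D\<close> is divided by \<open>\<gamma>\<close> at
  each transition. Hence a cycle of length \<open>R\<close> at the initial state gives
  \<open>D (t+R) s - D t s = c / \<gamma>^t\<close> with \<open>c\<close> independent of \<open>s\<close>. For two coprime cycle lengths
  these relations share a single potential \<open>e * (1 + 1/\<gamma> + \<dots> + 1/\<gamma>^(t-1))\<close>, and they connect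
  the times \<open>T - 1\<close> and \<open>T\<close> in every state. Since \<open>D T = 0\<close>, the function \<open>D (T-1)\<close>, which is the
  difference of the rewards, is constant. A self-loop is the case of cycle lengths \<open>1\<close> and \<open>1\<close>.
\<close>

section \<open>Arithmetic of cycle lengths\<close>

lemma nat_combination_of_coprime:
  fixes m x y :: nat
  assumes "coprime x y" and "x > 0" and "y > 0" and "x * y \<le> m + 1"
  shows "\<exists>i j. m = i * x + j * y"
proof -
  obtain z0 where "[x * z0 = 1] (mod y)"
    using cong_solve_coprime_nat[OF assms(1)] by auto
  then have "[x * z0 * m = 1 * m] (mod y)" by (rule cong_scalar_right)
  then obtain z where z: "[x * z = m] (mod y)" by (auto simp: mult.assoc)
  \<comment> \<open>The least residue keeps \<open>i * x\<close> at most \<open>x * y - x\<close>,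
    hence at most \<open>m\<close>, so the rest \<open>m - i * x\<close> is a genuine multiple of
    \<open>y\<close>.\<close>
  define i where "i = z mod y"
  have "i < y" using assms(3) by (simp add: i_def)
  have cong: "[i * x = m] (mod y)"
    using z by (simp add: i_def cong_def mod_mult_right_eq mult.commute)
  have "i * x \<le> (y - 1) * x"
    using \<open>i < y\<close> by (intro mult_le_mono1) simp
  also have "\<dots> = x * y - x"
    by (simp add: diff_mult_distrib2 mult.commute)
  also have "\<dots> \<le> m"
    using assms(2,4) by linarith
  finally have le: "i * x \<le> m" .
  then have "y dvd m - i * x"
    using cong by (simp add: cong_def flip: mod_eq_dvd_iff_nat)
  then obtain j where "m - i * x = y * j" ..
  with le have "m = i * x + j * y" by (simp add: mult.commute)
  then show ?thesis by blast
qed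

text \<open>The smallest positive difference \<open>k\<close> of two members divides every member by
  Euclidean descent, hence is 1. Applied to the cycle lengths at a state, this yields two coprime
  ones.\<close>

lemma consecutive_in_additive_set:
  fixes S :: "nat set"
  assumes add: "\<And>x y. x \<in> S \<Longrightarrow> y \<in> S \<Longrightarrow> x + y \<in> S"
    and pos: "0 \<notin> S"
    and gcd1: "\<not> (\<exists>k>1. \<forall>n\<in>S. k dvd n)"
  shows "\<exists>x. x \<in> S \<and> x + 1 \<in> S"
proof -
  define P where "P k \<longleftrightarrow> k > 0 \<and> (\<exists>y. y \<in> S \<and> y + k \<in> S)" for k
  obtain n0 where "n0 \<in> S" using gcd1 by (auto dest: spec[of _ 2])
  moreover from this have "n0 > 0" using pos by (cases n0) auto
  ultimately have "P n0" using add by (auto simp: P_def)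
  define k where "k = (LEAST k. P k)"
  have "P k" unfolding k_def by (rule LeastI) fact
  then obtain y where "k > 0" and y: "y \<in> S" "y + k \<in> S" by (auto simp: P_def)
  have mult: "j * x + x \<in> S" if "x \<in> S" for j x
    using that add by (induction j) (auto simp: add.assoc)
  have "k dvd n" if "n \<in> S" for n
  proof (rule ccontr)
    assume "\<not> k dvd n"
    define q r where "q = n div k" and "r = n mod k"
    have r: "0 < r" "r < k" and n: "n = q * k + r"
      using \<open>\<not> k dvd n\<close> \<open>k > 0\<close> by (auto simp: q_def r_def dvd_eq_mod_eq_0)
    \<comment> \<open>With \<open>n = q * k + r\<close>, the members
      \<open>(q + 1) * (y + k)\<close> and \<open>n + q * y + (y + k)\<close> differ by exactly
      \<open>r\<close>, which contradicts the minimality of \<open>k\<close>.\<close>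
    have lo: "(q * (y + k) + (y + k)) \<in> S" by (rule mult) fact
    have "n + (q * y + (y + k)) \<in> S"
    proof (induction q)
      case 0
      then show ?case using add[OF that y(2)] by simp
    next
      case (Suc q)
      then show ?case using add[OF y(1) Suc] by (simp add: algebra_simps)
    qed
    then have "(q * (y + k) + (y + k)) + r \<in> S"
      by (simp add: n algebra_simps)
    with lo r have "P r" by (auto simp: P_def)
    then have "k \<le> r" unfolding k_def by (rule Least_le)
    with r show False by simp
  qed
  then have "k = 1" using gcd1 \<open>k > 0\<close> by (cases "k > 1") auto
  with y show ?thesis by blast
qed

section \<open>Cycles of an irreducible aperiodic chain\<close>

lemma coprime_cycles:
  assumes irr: "irreducible_chain K" and ap: "aperiodic_chain K"
  shows "\<exists>R R'. has_cycle K s R \<and> has_cycle K s R' \<and> gcd R R' = 1"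
proof -
  have add: "has_cycle K s (m + n)" if "has_cycle K s m" "has_cycle K s n" for m n
    using that by (auto simp: has_cycle_def intro: relpow_trans)
  have gcd1: "k = 1" if k: "k > 0" "\<forall>n. has_cycle K s n \<longrightarrow> k dvd n" for k
  proof (rule ccontr)
    assume "k \<noteq> 1"
    \<comment> \<open>A closed walk from \<open>s\<close> through \<open>u\<close> can run the cycle
      at \<open>u\<close> once or twice, and the two lengths differ by \<open>n\<close>. Running it
      at least once keeps the length positive even if \<open>i = j = 0\<close>.\<close>
    have "k dvd n" if n: "has_cycle K u n" for u n
    proof -
      obtain i j where ij: "(s, u) \<in> transitions K ^^ i" "(u, s) \<in> transitions K ^^ j"
        using irr by (metis irreducible_chain_def rtrancl_imp_relpow)
      have un: "(u, u) \<in> transitions K ^^ n" and "n > 0"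
        using n by (auto simp: has_cycle_def)
      have "(s, s) \<in> transitions K ^^ (i + n + j)" "(s, s) \<in> transitions K ^^ (i + n + n + j)"
        using ij un by (blast intro: relpow_trans)+
      then have "k dvd i + n + j" "k dvd i + n + n + j"
        using k \<open>n > 0\<close> by (auto simp: has_cycle_def)
      moreover have "i + n + n + j = (i + n + j) + n" by simp
      ultimately show "k dvd n" by (metis dvd_add_right_iff)
    qed
    moreover have "k > 1" using k(1) \<open>k \<noteq> 1\<close> by simp
    ultimately show False using ap by (auto simp: aperiodic_chain_def)
  qed
  have "\<exists>x. x \<in> {n. has_cycle K s n} \<and> x + 1 \<in> {n. has_cycle K s n}"
  proof (rule consecutive_in_additive_set)
    show "0 \<notin> {n. has_cycle K s n}" by (simp add: has_cycle_def)
    show "\<not> (\<exists>k>1. \<forall>n\<in>{n. has_cycle K s n}. k dvd n)"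
    proof
      assume "\<exists>k>1. \<forall>n\<in>{n. has_cycle K s n}. k dvd n"
      then obtain k where "k > 1" "\<forall>n. has_cycle K s n \<longrightarrow> k dvd n" by auto
      with gcd1[of k] show False by simp
    qed
  qed (simp add: add)
  then obtain x where x: "has_cycle K s x" "has_cycle K s (x + 1)" by auto
  show ?thesis
    by (rule exI[of _ x], rule exI[of _ "x + 1"]) (use x in simp)
qed

lemma accessible_within_of_irreducible:
  fixes K :: "'s::finite \<Rightarrow> 'a \<Rightarrow> 's pmf"
  assumes "irreducible_chain K"
  shows "\<exists>d. accessible_within K s d"
proof -
  have "\<forall>u. \<exists>n. (s, u) \<in> transitions K ^^ n"
    using assms by (simp add: irreducible_chain_def rtrancl_power)
  then obtain n where n: "(s, u) \<in> transitions K ^^ n u" for u by metis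
  have "n u \<le> Max (range n)" for u by simp
  then show ?thesis using n unfolding accessible_within_def by blast
qed

section \<open>Consequence of the rank condition\<close>

lemma constant_on_successors:
  fixes K :: "'s::finite \<Rightarrow> 'a \<Rightarrow> 's pmf"
  assumes rank: "action_rank K s = card {s'. \<exists>a. pmf (K s a) s' > 0}"
    and mean: "\<And>a. (\<Sum>s'\<in>UNIV. pmf (K s a) s' * w s') = c"
    and "(s, u) \<in> transitions K"
  shows "w u = c"
proof -
  define S where "S = {s'. \<exists>a. pmf (K s a) s' > 0}"
  define v where "v a = ((\<chi> s'. pmf (K s a) s') :: real ^ 's)" for a
  \<comment> \<open>All transition vectors at \<open>s\<close> are supported on \<open>S\<close>, so
    they lie in the coordinate subspace \<open>W\<close>. The rank condition equates dimensions, so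
    they span \<open>W\<close>, which contains the unit vector of each successor.\<close>
  define W where "W = {x::real^'s. \<forall>i. i \<notin> S \<longrightarrow> x $ i = 0}"
  have "span (range v) \<subseteq> W"
  proof (rule span_minimal)
    show "range v \<subseteq> W"
      by (auto simp: W_def S_def v_def pmf_nonneg order.antisym not_less)
    show "subspace W" by (auto simp: W_def subspace_def)
  qed
  moreover have "dim (span (range v)) = dim W"
    using rank dim_substandard_cart[of S, where 'a=real]
    by (simp add: action_rank_def v_def[abs_def] W_def S_def dim_vec_eq)
  moreover have "subspace W" by (auto simp: W_def subspace_def)
  ultimately have span: "span (range v) = W"
    by (intro subspace_dim_equal) auto
  have "u \<in> S" using assms(3) by (auto simp: S_def transitions_def)
  then have "axis u 1 \<in> span (range v)"
    unfolding span by (auto simp: W_def axis_def)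
  \<comment> \<open>Each transition vector has entries summing to 1, so \<open>mean\<close> says
    that it is orthogonal to \<open>w - c\<close>. This passes to the span, and the unit vector at
    \<open>u\<close> reads off \<open>w u - c\<close>.\<close>
  moreover have "x \<bullet> (\<chi> s'. w s' - c) = 0" if "x \<in> span (range v)" for x
    using that
  proof (induction rule: span_induct)
    case (step x)
    then obtain a where "x = v a" by auto
    moreover have "(\<Sum>s'\<in>UNIV. pmf (K s a) s') = 1"
      by (rule sum_pmf_eq_1) auto
    ultimately show ?case
      using mean[of a] by (simp add: v_def inner_vec_def right_diff_distrib sum_subtractf
          flip: sum_distrib_right)
  next
    case base
    show ?case by (auto simp: subspace_def inner_add_left)
  qed
  ultimately have "axis u 1 \<bullet> (\<chi> s'. w s' - c) = 0" by blast
  then show ?thesis by (simp add: inner_axis')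
qed

section \<open>Differences of value functions along cycles\<close>

lemma cycle_shift:
  fixes K :: "'s::finite \<Rightarrow> 'a \<Rightarrow> 's pmf" and D :: "nat \<Rightarrow> 's \<Rightarrow> real"
  assumes "\<gamma> \<noteq> 0"
    and rank: "\<And>s. action_rank K s = card {s'. \<exists>a. pmf (K s a) s' > 0}"
    and bellman: "\<And>t s a. t < T \<Longrightarrow> (s\<^sub>0, s) \<in> transitions K ^^ t \<Longrightarrow>
      h s a = D t s - \<gamma> * (\<Sum>s'\<in>UNIV. pmf (K s a) s' * D (Suc t) s')"
    and cycle: "(s\<^sub>0, s\<^sub>0) \<in> transitions K ^^ R"
    and "(s\<^sub>0, s) \<in> transitions K ^^ t" and "t + R \<le> T"
  shows "D (t + R) s - D t s = (D R s\<^sub>0 - D 0 s\<^sub>0) * (1 / \<gamma>) ^ t"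
  using assms(5,6)
proof (induction t arbitrary: s)
  case 0
  then show ?case by simp
next
  case (Suc t)
  then obtain u where u: "(s\<^sub>0, u) \<in> transitions K ^^ t" "(u, s) \<in> transitions K" by auto
  \<comment> \<open>Running the cycle before the walk to \<open>u\<close> makes \<open>u\<close>
    occupied at time \<open>t + R\<close> too, so \<open>bellman\<close> applies at both times and
    \<open>h u a\<close> cancels.\<close>
  have uR: "(s\<^sub>0, u) \<in> transitions K ^^ (t + R)"
    using relpow_trans[OF cycle u(1)] by (simp add: add.commute)
  have "(\<Sum>s'\<in>UNIV. pmf (K u a) s' * (D (Suc t + R) s' - D (Suc t) s')) = (D (t + R) u - D t u) / \<gamma>"
    for a
    using bellman[OF _ u(1), of a] bellman[OF _ uR, of a] Suc.prems(2) \<open>\<gamma> \<noteq> 0\<close>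
    by (simp add: right_diff_distrib sum_subtractf field_simps)
  from constant_on_successors[OF rank this u(2)]
  show ?case using Suc.IH[OF u(1)] Suc.prems(2) by simp
qed

text \<open>Used with \<open>A\<close> the times at which one state can be occupied and
  \<open>G\<close> a value difference corrected to be invariant under the shift by a cycle length.
  Invariance is available only up to the horizon, hence the bounds by \<open>T\<close>.\<close>

lemma shift_invariant:
  fixes G :: "nat \<Rightarrow> 'b"
  assumes "\<And>k. k \<in> A \<Longrightarrow> k + x \<in> A" and "\<And>k. k \<in> A \<Longrightarrow> k + x \<le> T \<Longrightarrow> G (k + x) = G k"
    and "n \<in> A" and "n + i * x \<le> T"
  shows "n + i * x \<in> A \<and> G (n + i * x) = G n"
  using assms(4)
proof (induction i)
  case 0
  then show ?case using assms(3) by simp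
next
  case (Suc i)
  then have IH: "n + i * x \<in> A" "G (n + i * x) = G n" by auto
  have eq: "n + Suc i * x = (n + i * x) + x" by simp
  show ?case using assms(1)[OF IH(1)] assms(2)[OF IH(1)] IH Suc.prems unfolding eq by simp
qed

lemma final_difference_constant:
  fixes K :: "'s::finite \<Rightarrow> 'a \<Rightarrow> 's pmf" and D :: "nat \<Rightarrow> 's \<Rightarrow> real"
  assumes "\<gamma> > 0"
    and rank: "\<And>s. action_rank K s = card {s'. \<exists>a. pmf (K s a) s' > 0}"
    and bellman: "\<And>t s a. t < T \<Longrightarrow> (s\<^sub>0, s) \<in> transitions K ^^ t \<Longrightarrow>
      h s a = D t s - \<gamma> * (\<Sum>s'\<in>UNIV. pmf (K s a) s' * D (Suc t) s')"
    and final: "\<And>s. D T s = 0"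
    and cycles: "has_cycle K s\<^sub>0 R" "has_cycle K s\<^sub>0 R'" "gcd R R' = 1"
    and acc: "accessible_within K s\<^sub>0 d" and T: "d + R * R' \<le> T"
  shows "\<exists>c. \<forall>s a. h s a = c"
proof -
  have pos: "R > 0" "R' > 0"
    and cyc: "(s\<^sub>0, s\<^sub>0) \<in> transitions K ^^ R" "(s\<^sub>0, s\<^sub>0) \<in> transitions K ^^ R'"
    using cycles by (auto simp: has_cycle_def)
  have RR: "R * R' > 0" using pos by simp
  \<comment> \<open>Without a closed form of this geometric sum, \<gamma> = 1 needs no separate
    case. By \<open>E_add\<close>, the shift differences of \<open>E\<close> have the same
    dependence on \<open>t\<close> as those of \<open>D\<close>.\<close>
  define E where "E t = (\<Sum>i<t. (1 / \<gamma>) ^ i)" for t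
  have E_pos: "E t > 0" if "t > 0" for t
    unfolding E_def using that assms(1) by (intro sum_pos) auto
  have E_add: "E (t + r) - E t = E r * (1 / \<gamma>) ^ t" for t r
    by (induction r) (simp_all add: E_def algebra_simps power_add)
  define c c' where "c = D R s\<^sub>0 - D 0 s\<^sub>0" and "c' = D R' s\<^sub>0 - D 0 s\<^sub>0"
  have shift: "D (t + r) s - D t s = (D r s\<^sub>0 - D 0 s\<^sub>0) * (1 / \<gamma>) ^ t"
    if "(s\<^sub>0, s\<^sub>0) \<in> transitions K ^^ r" "(s\<^sub>0, s) \<in> transitions K ^^ t" "t + r \<le> T" for r s t
    using assms(1) cycle_shift[where K = K and D = D and h = h, OF _ rank bellman that] by simp
  \<comment> \<open>Subtracting a multiple of \<open>E\<close> turns \<open>shift\<close> into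
    invariance. So far the multiple depends on the cycle length \<open>r\<close>.\<close>
  have corrected: "D (t + r) s - (D r s\<^sub>0 - D 0 s\<^sub>0) / E r * E (t + r)
      = D t s - (D r s\<^sub>0 - D 0 s\<^sub>0) / E r * E t"
    if "r > 0" "(s\<^sub>0, s\<^sub>0) \<in> transitions K ^^ r" "(s\<^sub>0, s) \<in> transitions K ^^ t" "t + r \<le> T"
    for r s t
  proof -
    have "(D r s\<^sub>0 - D 0 s\<^sub>0) / E r * (E (t + r) - E t) = D (t + r) s - D t s"
      using shift[OF that(2-)] E_pos[OF that(1)] by (simp add: E_add)
    then show ?thesis by (simp only: right_diff_distrib)
  qed
  have around: "D (i * r) s\<^sub>0 - (D r s\<^sub>0 - D 0 s\<^sub>0) / E r * E (i * r) = D 0 s\<^sub>0"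
    if "r > 0" "(s\<^sub>0, s\<^sub>0) \<in> transitions K ^^ r" "i * r \<le> T" for i r
    using shift_invariant[of "{t. (s\<^sub>0, s\<^sub>0) \<in> transitions K ^^ t}" r T
        "\<lambda>t. D t s\<^sub>0 - (D r s\<^sub>0 - D 0 s\<^sub>0) / E r * E t" 0 i] corrected[OF that(1,2)] that
    by (auto simp: E_def intro: relpow_trans)
  define e where "e = c / E R"
  \<comment> \<open>going \<open>R'\<close> times around the first cycle takes as long as \<open>R\<close> times around the second\<close>
  have "c / E R * E (R * R') = c' / E R' * E (R * R')"
    using around[OF pos(1) cyc(1), of R'] around[OF pos(2) cyc(2), of R] T
    by (simp add: c_def c'_def mult.commute)
  then have e': "e = c' / E R'"
    using E_pos[OF RR] by (simp only: e_def mult_cancel_right) simp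
  have "h s a = - e * (1 / \<gamma>) ^ (T - 1)" for s a
  proof -
    define A where "A = {t. (s\<^sub>0, s) \<in> transitions K ^^ t}"
    define G where "G t = D t s - e * E t" for t
    have closed: "k + R \<in> A" "k + R' \<in> A" if "k \<in> A" for k
      using relpow_trans[OF cyc(1), of s k] relpow_trans[OF cyc(2), of s k] that
      by (auto simp: A_def add.commute)
    have inv: "k + R \<le> T \<Longrightarrow> G (k + R) = G k" "k + R' \<le> T \<Longrightarrow> G (k + R') = G k" if "k \<in> A" for k
      using that corrected[OF pos(1) cyc(1), of s k] corrected[OF pos(2) cyc(2), of s k]
      by (auto simp: A_def G_def e_def c_def[symmetric] e'[unfolded e_def] c'_def)
    obtain n where n: "n \<le> d" "n \<in> A"
      using acc by (auto simp: accessible_within_def A_def)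
    \<comment> \<open>Steps of lengths \<open>R\<close> and \<open>R'\<close> lead from
      \<open>n\<close> to \<open>t\<close> within \<open>A\<close>. Such combinations already exist
      from \<open>R * R' - 1\<close> on, and this gain of one admits \<open>t = T - 1\<close> even
      when \<open>T = d + R * R'\<close>.\<close>
    have connected: "t \<in> A \<and> G t = G n" if "t \<le> T" "n + R * R' \<le> t + 1" for t
    proof -
      have "n \<le> t" using that RR by linarith
      have "R * R' \<le> (t - n) + 1" using that \<open>n \<le> t\<close> by linarith
      then obtain i j where "t - n = i * R + j * R'"
        using nat_combination_of_coprime[OF _ pos] cycles(3) by (metis coprime_iff_gcd_eq_1)
      then have t: "t = (n + i * R) + j * R'" using \<open>n \<le> t\<close> by simp
      have 1: "n + i * R \<in> A \<and> G (n + i * R) = G n"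
        using that t by (intro shift_invariant[where T = T] closed inv n) auto
      then have "(n + i * R) + j * R' \<in> A \<and> G ((n + i * R) + j * R') = G (n + i * R)"
        using that t by (intro shift_invariant[where T = T] closed inv) auto
      with 1 t show ?thesis by simp
    qed
    have "T > 0" using T RR by linarith
    have "T - 1 \<in> A" "G (T - 1) = G T"
      using connected[of T] connected[of "T - 1"] T n(1) \<open>T > 0\<close> by auto
    moreover have "E T - E (T - 1) = (1 / \<gamma>) ^ (T - 1)"
      using E_add[of "T - 1" 1] \<open>T > 0\<close> by (simp add: E_def)
    ultimately have "D (T - 1) s = - e * (1 / \<gamma>) ^ (T - 1)"
      using final[of s] by (simp add: G_def algebra_simps)
    then show ?thesis
      using bellman[of "T - 1" s a] \<open>T - 1 \<in> A\<close> \<open>T > 0\<close> final by (simp add: A_def)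
  qed
  then show ?thesis by blast
qed

section \<open>From equal policies to rewards equal up to a constant\<close>

lemma well_posed_of_coprime_cycles:
  fixes K :: "'s::finite \<Rightarrow> 'a::finite \<Rightarrow> 's pmf"
  assumes "\<gamma> > 0" and "lam > 0"
    and rank: "\<And>s. action_rank K s = card {s'. \<exists>a. pmf (K s a) s' > 0}"
    and cycles: "has_cycle K s\<^sub>0 R" "has_cycle K s\<^sub>0 R'" "gcd R R' = 1"
    and acc: "accessible_within K s\<^sub>0 d" and T: "d + R * R' \<le> T"
  shows "irl_well_posed K \<gamma> lam g T s\<^sub>0"
  unfolding irl_well_posed_def
proof (intro allI impI, elim conjE)
  fix p f f'
  assume gen: "generates_policy K \<gamma> lam g T s\<^sub>0 f p" "generates_policy K \<gamma> lam g T s\<^sub>0 f' p"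
  define D where "D t s = opt_value K \<gamma> lam f' g T t s - opt_value K \<gamma> lam f g T t s" for t s
  have "f' s a - f s a = D t s - \<gamma> * (\<Sum>s'\<in>UNIV. pmf (K s a) s' * D (Suc t) s')"
    if "t < T" "(s\<^sub>0, s) \<in> transitions K ^^ t" for t s a
  proof -
    have "opt_policy K \<gamma> lam f g T t s a = opt_policy K \<gamma> lam f' g T t s a"
      using gen that by (simp add: generates_policy_def)
    \<comment> \<open>Since \<open>exp\<close> is injective, equal policies have equal advantages;
      rearranging gives the recursion for \<open>D\<close> with \<open>f' - f\<close> as
      reward.\<close>
    then have "opt_action_value K \<gamma> lam f g T t s a - opt_value K \<gamma> lam f g T t s
        = opt_action_value K \<gamma> lam f' g T t s a - opt_value K \<gamma> lam f' g T t s"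
      using assms(2) by (simp add: opt_policy_def)
    then show ?thesis
      by (simp add: opt_action_value_def action_value_def D_def right_diff_distrib sum_subtractf)
  qed
  note bellman = this
  have final: "D T s = 0" for s by (simp add: D_def opt_value.simps[of _ _ _ _ _ T T])
  have "\<exists>c. \<forall>s a. f' s a - f s a = c"
    using assms(1) by (rule final_difference_constant) (fact rank bellman final cycles acc T)+
  then obtain c where "\<forall>s a. f' s a - f s a = c" by blast
  then show "\<exists>c. \<forall>s a. f' s a = f s a + c"
    by (intro exI[of _ c]) (simp add: algebra_simps)
qed

theorem corollary2:
  fixes K :: "'s::finite \<Rightarrow> 'a::finite \<Rightarrow> 's pmf"
    and \<gamma> lam :: real
    and g :: "'s \<Rightarrow> real"
    and s\<^sub>0 :: 's
  assumes "0 < \<gamma>" and "\<gamma> \<le> 1" and "0 < lam"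
    and "\<And>s. action_rank K s = card {s'. \<exists>a. pmf (K s a) s' > 0}"
  shows
    "((irreducible_chain K \<and> aperiodic_chain K)
        \<or> (\<exists>d. (s\<^sub>0, s\<^sub>0) \<in> transitions K \<and> accessible_within K s\<^sub>0 d)
        \<or> (\<exists>d R R'. has_cycle K s\<^sub>0 R \<and> has_cycle K s\<^sub>0 R' \<and> gcd R R' = 1
              \<and> accessible_within K s\<^sub>0 d)
      \<longrightarrow> (\<exists>T. irl_well_posed K \<gamma> lam g T s\<^sub>0))
     \<and> (\<forall>d. (s\<^sub>0, s\<^sub>0) \<in> transitions K \<and> accessible_within K s\<^sub>0 d
          \<longrightarrow> (\<forall>T\<ge>d + 1. irl_well_posed K \<gamma> lam g T s\<^sub>0))
     \<and> (\<forall>d R R'. has_cycle K s\<^sub>0 R \<and> has_cycle K s\<^sub>0 R' \<and> gcd R R' = 1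
            \<and> accessible_within K s\<^sub>0 d
          \<longrightarrow> (\<forall>T\<ge>d + R * R'. irl_well_posed K \<gamma> lam g T s\<^sub>0))"
proof -
  note wp = well_posed_of_coprime_cycles[OF assms(1,3,4)]
  \<comment> \<open>The loop serves as both cycles, so the bound \<open>d + R * R'\<close> becomes
    \<open>d + 1\<close>.\<close>
  have loop: "irl_well_posed K \<gamma> lam g T s\<^sub>0"
    if "(s\<^sub>0, s\<^sub>0) \<in> transitions K" "accessible_within K s\<^sub>0 d" "T \<ge> d + 1" for d T
    using that by (intro wp[of s\<^sub>0 1 1 d]) (auto simp: has_cycle_def)
  have coprime: "irl_well_posed K \<gamma> lam g T s\<^sub>0"
    if "has_cycle K s\<^sub>0 R \<and> has_cycle K s\<^sub>0 R' \<and> gcd R R' = 1 \<and> accessible_within K s\<^sub>0 d"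
      and "T \<ge> d + R * R'" for d R R' T
    using that by (intro wp[of s\<^sub>0 R R' d]) auto
  \<comment> \<open>This reduces the irreducible aperiodic case to that of coprime cycles, with some
    \<open>d\<close> supplied by finiteness of the state space.\<close>
  have irr: "\<exists>d R R'. has_cycle K s\<^sub>0 R \<and> has_cycle K s\<^sub>0 R' \<and> gcd R R' = 1
      \<and> accessible_within K s\<^sub>0 d"
    if "irreducible_chain K" "aperiodic_chain K"
    using coprime_cycles[OF that, of s\<^sub>0] accessible_within_of_irreducible[OF that(1), of s\<^sub>0]
    by metis
  show ?thesis
    using loop coprime irr by (meson order_refl)
qed

end
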